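(* Let $q$ be a prime power, let $1\le r\le k$, and let $C$ be an $[n,k]_q$ code that is an $r$-th generalized Griesmer code. Write $d_i=d_i(C)$. 1. For $1\le h<r$, let $A\le C$ be an $h$-dimensional subcode with support weight $d_h$. The residual code $R=\mathrm{Res}(C,A)$ has dimension $k-h$ and satisfies $$n(R)=g_q^{(r-h)}(k-h,d_r-d_h),\qquad d_{r-h}(R)=d_r-d_h.$$ Thus $R$ is an $(r-h)$-th generalized Griesmer code. 2. If $r<k$, let $A\le C$ be an $r$-dimensional subcode with support weight $d_r$. The residual code $R=\mathrm{Res}(C,A)$ has length $g_q(k-r,d_{r+1}-d_r)$, dimension $k-r$ and minimum distance $d_{r+1}-d_r$, and is a Griesmer code.
   Context: An $[n,k]_q$ code is a $k$-dimensional linear subspace $C\le\mathbb{F}_q^n$. For a subcode $A\le C$, $\mathrm{supp}(A)$ is the set of coordinates $j$ such that $a_j\neq 0$ for some $a\in A$, and its support weight is $w(A)=|\mathrm{supp}(A)|$. The effective length of $C$ is $n(C)=w(C)$; $C$ has full length if $n(C)=n$. For $1\le r\le k$, $d_r(C)$ is the minimum of $w(A)$ over all $r$-dimensional subcodes $A\le C$; so $d_1(C)$ is the minimum distance. Put ${r\brack 1}_q=(q^r-1)/(q-1)$ and, for integers $x\ge 0$ and $1\le r\le k$, $$g_q^{(r)}(k,x)=x+\sum_{i=1}^{k-r}\left\lceil\frac{x}{q^i{r\brack 1}_q}\right\rceil,\qquad g_q(k,x)=g_q^{(1)}(k,x)$$ (empty sums are zero). A full-length $[n,k]_q$ code $C$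 is an $r$-th generalized Griesmer code if $n=g_q^{(r)}(k,d_r(C))$; a Griesmer code is a first ($r=1$) generalized Griesmer code. For a subcode $A\le C$, the residual code is $\mathrm{Res}(C,A)=\{(c_j)_{j\notin\mathrm{supp}(A)}:c\in C\}$; coordinates that are identically zero after puncturing are deleted, so residual codes are always written with their effective lengths. *)

theory Defs
  imports Complex_Main "HOL-Library.Cardinality" "HOL-Library.Function_Algebras"
begin

text \<open>
  The field with q elements is a type of classes \<open>field\<close> and \<open>finite\<close>, and q is its
  cardinality. The space of words with coordinates in a finite set \<open>I\<close> consists of the functions
  that vanish outside \<open>I\<close>; the length is the cardinality of \<open>I\<close>. Keeping the coordinate set
  explicit lets residual codes, whose length is smaller, have the same type.
\<close>

definition vscale :: "'a::field \<Rightarrow> ('i \<Rightarrow> 'a) \<Rightarrow> 'i \<Rightarrow> 'a" where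
  "vscale a c = (\<lambda>j. a * c j)"

global_interpretation word: vector_space "vscale :: 'a::field \<Rightarrow> ('i \<Rightarrow> 'a) \<Rightarrow> 'i \<Rightarrow> 'a"
  by unfold_locales (auto simp: vscale_def fun_eq_iff algebra_simps)

definition words :: "'i set \<Rightarrow> ('i \<Rightarrow> 'a::field) set" where
  "words I = {c. \<forall>j. j \<notin> I \<longrightarrow> c j = 0}"

definition linear_code :: "'i set \<Rightarrow> nat \<Rightarrow> nat \<Rightarrow> ('i \<Rightarrow> 'a::{field,finite}) set \<Rightarrow> bool" where
  "linear_code I n k C \<longleftrightarrow>
     finite I \<and> card I = n \<and> C \<subseteq> words I \<and> word.subspace C \<and> word.dim C = k"

definition subcode :: "('i \<Rightarrow> 'a::field) set \<Rightarrow> ('i \<Rightarrow> 'a) set \<Rightarrow> bool" where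
  "subcode A C \<longleftrightarrow> A \<subseteq> C \<and> word.subspace A"

definition supp :: "('i \<Rightarrow> 'a::zero) set \<Rightarrow> 'i set" where
  "supp A = {j. \<exists>a\<in>A. a j \<noteq> 0}"

definition support_weight :: "('i \<Rightarrow> 'a::zero) set \<Rightarrow> nat" where
  "support_weight A = card (supp A)"

abbreviation effective_length :: "('i \<Rightarrow> 'a::zero) set \<Rightarrow> nat" where
  "effective_length C \<equiv> support_weight C"

definition gen_weight :: "nat \<Rightarrow> ('i \<Rightarrow> 'a::field) set \<Rightarrow> nat" where
  "gen_weight r C = (LEAST w. \<exists>A. subcode A C \<and> word.dim A = r \<and> support_weight A = w)"

definition hamming_dist :: "('i \<Rightarrow> 'a) \<Rightarrow> ('i \<Rightarrow> 'a) \<Rightarrow> nat" where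
  "hamming_dist c c' = card {j. c j \<noteq> c' j}"

definition min_distance :: "('i \<Rightarrow> 'a) set \<Rightarrow> nat" where
  "min_distance C = (LEAST d. \<exists>c\<in>C. \<exists>c'\<in>C. c \<noteq> c' \<and> hamming_dist c c' = d)"

definition gauss_num :: "nat \<Rightarrow> nat \<Rightarrow> real" where
  "gauss_num q r = (real q ^ r - 1) / (real q - 1)"

definition gen_griesmer_bound :: "nat \<Rightarrow> nat \<Rightarrow> nat \<Rightarrow> nat \<Rightarrow> nat" where
  "gen_griesmer_bound q r k x = x + (\<Sum>i = 1..k - r. nat \<lceil>real x / (real q ^ i * gauss_num q r)\<rceil>)"

abbreviation griesmer_bound :: "nat \<Rightarrow> nat \<Rightarrow> nat \<Rightarrow> nat" where
  "griesmer_bound q k x \<equiv> gen_griesmer_bound q 1 k x"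

definition gen_griesmer_code ::
    "nat \<Rightarrow> 'i set \<Rightarrow> nat \<Rightarrow> nat \<Rightarrow> ('i \<Rightarrow> 'a::{field,finite}) set \<Rightarrow> bool" where
  "gen_griesmer_code r I n k C \<longleftrightarrow>
     1 \<le> r \<and> r \<le> k \<and> linear_code I n k C \<and> effective_length C = n \<and>
     n = gen_griesmer_bound CARD('a) r k (gen_weight r C)"

abbreviation griesmer_code ::
    "'i set \<Rightarrow> nat \<Rightarrow> nat \<Rightarrow> ('i \<Rightarrow> 'a::{field,finite}) set \<Rightarrow> bool" where
  "griesmer_code I n k C \<equiv> gen_griesmer_code 1 I n k C"

text \<open>
  Puncturing at the support of \<open>A\<close> sets those coordinates to zero. Deleting the coordinates that
  are identically zero means regarding the residual code \<open>R\<close> as a code with coordinate set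
  \<open>supp R\<close>, so that its length is \<open>effective_length R\<close>.
\<close>

definition residual :: "('i \<Rightarrow> 'a::zero) set \<Rightarrow> ('i \<Rightarrow> 'a) set \<Rightarrow> ('i \<Rightarrow> 'a) set" where
  "residual C A = (\<lambda>c j. if j \<in> supp A then 0 else c j) ` C"

end

theory Submission
  imports Defs "HOL-Library.FuncSet"
begin

text \<open>
  Averaging support weights over the hyperplanes of a subcode gives
  \<open>(q\<^sup>r\<^sup>+\<^sup>1 - 1) d\<^sub>r \<le> (q\<^sup>r\<^sup>+\<^sup>1 - q) d\<^sub>r\<^sub>+\<^sub>1\<close>; chaining these inequalities yields the generalized
  Griesmer bound and lower bounds on the differences of weights. Every \<open>s\<close>-dimensional subcode of
  the residual \<open>R\<close> of an \<open>h\<close>-dimensional subcode of minimum weight lifts to \<open>C\<close>, so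
  \<open>d\<^sub>s(R) \<ge> d\<^sub>h\<^sub>+\<^sub>s - d\<^sub>h\<close>. The Griesmer bound for \<open>R\<close>, with \<open>s = r - h\<close> in the first part and with
  \<open>h = r\<close>, \<open>s = 1\<close> in the second, is then at least the length \<open>n - d\<^sub>h\<close> of \<open>R\<close>, which forces equality.
\<close>

section \<open>Finite subspaces\<close>

lemma card_field_ge_2: "2 \<le> CARD('a::{field,finite})"
proof -
  have "card {0, 1 :: 'a} \<le> CARD('a)"
    by (rule card_mono) auto
  then show ?thesis by simp
qed

text \<open>Each fibre is a translate of the kernel. Additivity is asked for only on
  \<open>S\<close>, because functionals built from \<open>word.representation\<close> are known to
  be additive only on the span of the basis.\<close>

lemma card_eq_card_kernel_times_card_image:
  fixes f :: "'b::ab_group_add \<Rightarrow> 'c::ab_group_add"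
  assumes "finite S"
    and plus: "\<And>x y. x \<in> S \<Longrightarrow> y \<in> S \<Longrightarrow> x + y \<in> S"
    and minus: "\<And>x y. x \<in> S \<Longrightarrow> y \<in> S \<Longrightarrow> x - y \<in> S"
    and add: "\<And>x y. x \<in> S \<Longrightarrow> y \<in> S \<Longrightarrow> f (x + y) = f x + f y"
  shows "card S = card {x \<in> S. f x = 0} * card (f ` S)"
proof -
  have fibre: "card {x \<in> S. f x = y} = card {x \<in> S. f x = 0}" if "y \<in> f ` S" for y
  proof -
    from that obtain z where z: "z \<in> S" "f z = y" by auto
    have diff: "f (x - z) = f x - f z" if "x \<in> S" for x
      using add[of "x - z" z] minus[of x z] that z by (simp add: eq_diff_eq)
    have "bij_betw (\<lambda>x. x + z) {x \<in> S. f x = 0} {x \<in> S. f x = y}"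
      by (rule bij_betw_byWitness[where f' = "\<lambda>x. x - z"])
        (auto simp: z add diff plus minus)
    then show ?thesis by (simp add: bij_betw_same_card)
  qed
  have "card S = (\<Sum>y \<in> f ` S. card {x \<in> S. f x = y})"
    using sum.image_gen[OF \<open>finite S\<close>, of "\<lambda>_. 1 :: nat" f] by simp
  also have "\<dots> = card {x \<in> S. f x = 0} * card (f ` S)"
    by (simp add: fibre)
  finally show ?thesis .
qed

lemma card_words:
  assumes "finite I"
  shows "card (words I :: ('i \<Rightarrow> 'a::{field,finite}) set) = CARD('a) ^ card I"
proof -
  have "bij_betw (\<lambda>c. restrict c I) (words I :: ('i \<Rightarrow> 'a) set) (I \<rightarrow>\<^sub>E UNIV)"
    by (rule bij_betw_byWitness[where f' = "\<lambda>c j. if j \<in> I then c j else 0"])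
      (auto simp: words_def fun_eq_iff PiE_def extensional_def)
  then show ?thesis
    using assms by (simp add: bij_betw_same_card card_funcsetE)
qed

lemma finite_words:
  assumes "finite I"
  shows "finite (words I :: ('i \<Rightarrow> 'a::{field,finite}) set)"
  by (rule card_ge_0_finite) (simp add: card_words assms)

text \<open>Coordinate functions with respect to \<open>B\<close> are themselves words, with index
  set \<open>B\<close>, so \<open>card_words\<close> counts the span.\<close>

lemma card_span_independent:
  fixes B :: "('i \<Rightarrow> 'a::{field,finite}) set"
  assumes B: "word.independent B" and "finite B"
  shows "card (word.span B) = CARD('a) ^ card B"
proof -
  define lc where "lc u = (\<Sum>b\<in>B. vscale (u b) b)" for u :: "('i \<Rightarrow> 'a) \<Rightarrow> 'a"
  have "bij_betw (word.representation B) (word.span B) (words B)"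
  proof (rule bij_betw_byWitness[where f' = lc])
    show "\<forall>v\<in>word.span B. lc (word.representation B v) = v"
      using assms by (auto simp: lc_def word.sum_representation_eq)
    show "\<forall>u\<in>words B. word.representation B (lc u) = u"
    proof
      fix u :: "('i \<Rightarrow> 'a) \<Rightarrow> 'a" assume u: "u \<in> words B"
      have lc: "lc u = (\<Sum>b | u b \<noteq> 0. vscale (u b) b)"
        unfolding lc_def using u \<open>finite B\<close>
        by (intro sum.mono_neutral_right) (auto simp: words_def)
      show "word.representation B (lc u) = u"
      proof (rule word.representation_eqI[OF B])
        show "lc u \<in> word.span B"
          unfolding lc_def by (intro word.span_sum word.span_scale word.span_base)
        show "finite {b. u b \<noteq> 0}"
          using u \<open>finite B\<close> by (auto simp: words_def elim: rev_finite_subset)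
      qed (use u lc in \<open>auto simp: words_def\<close>)
    qed
    show "word.representation B ` word.span B \<subseteq> words B"
      using word.representation_ne_zero by (auto simp: words_def)
    show "lc ` words B \<subseteq> word.span B"
      unfolding lc_def by (auto intro: word.span_sum word.span_scale word.span_base)
  qed
  then show ?thesis
    using assms by (simp add: bij_betw_same_card card_words)
qed

lemma subspace_basis:
  fixes S :: "('i \<Rightarrow> 'a::field) set"
  assumes "word.subspace S" "finite S"
  obtains B where "B \<subseteq> S" "word.independent B" "word.span B = S" "card B = word.dim S" "finite B"
proof -
  obtain B where B: "B \<subseteq> S" "word.independent B" "S \<subseteq> word.span B" "card B = word.dim S"
    using word.basis_exists by blast
  moreover have "word.span B = S"
    using B assms(1) by (simp add: word.span_subspace)
  ultimately show ?thesis
    using that assms(2) finite_subset by blast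
qed

text \<open>Dimensions can thus be read off from cardinalities, and counting fibres takes the place
  of rank-nullity.\<close>

lemma card_subspace:
  fixes S :: "('i \<Rightarrow> 'a::{field,finite}) set"
  assumes "word.subspace S" "finite S"
  shows "card S = CARD('a) ^ word.dim S"
  by (metis assms subspace_basis card_span_independent)

lemma dim_eqI:
  fixes S :: "('i \<Rightarrow> 'a::{field,finite}) set"
  assumes "word.subspace S" "finite S" "card S = CARD('a) ^ m"
  shows "word.dim S = m"
  using card_subspace[OF assms(1,2)] assms(3) card_field_ge_2[where 'a='a] by simp

lemma card_subspace_le_iff:
  fixes S :: "('i \<Rightarrow> 'a::{field,finite}) set"
  assumes "word.subspace S" "finite S"
  shows "CARD('a) ^ m \<le> card S \<longleftrightarrow> m \<le> word.dim S"
  using card_subspace[OF assms] card_field_ge_2[where 'a='a] by simp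

lemma subspace_of_dim:
  fixes S :: "('i \<Rightarrow> 'a::field) set"
  assumes "word.subspace S" "finite S" "m \<le> word.dim S"
  obtains T where "subcode T S" "word.dim T = m"
proof -
  obtain B where B: "B \<subseteq> S" "word.independent B" "card B = word.dim S" "finite B"
    using subspace_basis[OF assms(1,2)] by blast
  obtain B' where B': "B' \<subseteq> B" "card B' = m"
    using assms(3) B(3) by (metis obtain_subset_with_card_n)
  have "subcode (word.span B') S"
    using B B' assms(1) word.span_minimal[of B' S] by (auto simp: subcode_def)
  moreover have "word.dim (word.span B') = m"
    using B B' word.independent_mono by (metis word.dim_span_eq_card_independent)
  ultimately show ?thesis using that by blast
qed

section \<open>Generalized weights\<close>

lemma linear_code_finite: "linear_code I n k C \<Longrightarrow> finite C"
  unfolding linear_code_def using finite_words finite_subset by blast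

lemma subcode_finite: "linear_code I n k C \<Longrightarrow> subcode A C \<Longrightarrow> finite A"
  by (metis linear_code_finite subcode_def finite_subset)

lemma supp_mono: "A \<subseteq> C \<Longrightarrow> supp A \<subseteq> supp C"
  by (auto simp: supp_def)

lemma linear_code_finite_supp: "linear_code I n k C \<Longrightarrow> finite (supp C)"
  by (rule finite_subset[of _ I]) (auto simp: linear_code_def words_def supp_def)

lemma gen_weight_le:
  fixes C :: "('i \<Rightarrow> 'a::{field,finite}) set"
  assumes "subcode A C" "word.dim A = r"
  shows "gen_weight r C \<le> support_weight A"
  unfolding gen_weight_def using assms by (auto intro: Least_le)

text \<open>A subspace of \<open>A\<close> of dimension exactly \<open>r\<close> has no larger
  support. This form suits kernels, where counting gives only a lower bound on the
  dimension.\<close>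

lemma gen_weight_le_of_le_dim:
  fixes C :: "('i \<Rightarrow> 'a::{field,finite}) set"
  assumes "linear_code I n k C" "subcode A C" "r \<le> word.dim A"
  shows "gen_weight r C \<le> support_weight A"
proof -
  obtain T where T: "subcode T A" "word.dim T = r"
    using subspace_of_dim assms subcode_finite by (metis subcode_def)
  have "gen_weight r C \<le> support_weight T"
    by (rule gen_weight_le) (use T assms in \<open>auto simp: subcode_def\<close>)
  also have "\<dots> \<le> support_weight A"
    unfolding support_weight_def
    by (rule card_mono)
      (use T assms linear_code_finite_supp[OF assms(1)] supp_mono[of A C] supp_mono[of T A]
        in \<open>auto simp: subcode_def intro: finite_subset\<close>)
  finally show ?thesis .
qed

lemma gen_weight_attained:
  fixes C :: "('i \<Rightarrow> 'a::{field,finite}) set"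
  assumes "linear_code I n k C" "r \<le> k"
  obtains A where "subcode A C" "word.dim A = r" "support_weight A = gen_weight r C"
proof -
  have "\<exists>w A. subcode A C \<and> word.dim A = r \<and> support_weight A = w"
    using subspace_of_dim[of C r] assms linear_code_finite[OF assms(1)]
    by (metis linear_code_def)
  from LeastI_ex[OF this] show ?thesis
    unfolding gen_weight_def[symmetric] using that by blast
qed

text \<open>A subcode of weight zero has at most one element, whereas dimension at least one forces
  at least \<open>CARD('a)\<close> elements.\<close>

lemma gen_weight_pos:
  fixes C :: "('i \<Rightarrow> 'a::{field,finite}) set"
  assumes C: "linear_code I n k C" and "1 \<le> r" "r \<le> k"
  shows "0 < gen_weight r C"
proof (rule ccontr)
  assume "\<not> ?thesis"
  moreover obtain A where A: "subcode A C" "word.dim A = r" "support_weight A = gen_weight r C"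
    using gen_weight_attained assms by blast
  moreover have "finite (supp A)"
    using A linear_code_finite_supp[OF C] supp_mono[of A C]
    by (auto simp: subcode_def intro: finite_subset)
  ultimately have "supp A = {}"
    by (simp add: support_weight_def)
  then have "A \<subseteq> {0}"
    by (auto simp: supp_def fun_eq_iff)
  then have "card A \<le> 1"
    by (metis card_mono card.insert card.empty empty_iff finite.emptyI finite.insertI One_nat_def)
  moreover have "CARD('a) ^ 1 \<le> card A"
    using A assms subcode_finite[OF C] by (subst card_subspace_le_iff) (auto simp: subcode_def)
  ultimately show False
    using card_field_ge_2[where 'a='a] by simp
qed

text \<open>
  Average the support weight over the hyperplanes of a subcode \<open>D\<close> that realizes the
  \<open>Suc r\<close>-th weight, each hyperplane being the kernel of \<open>q - 1\<close> functionals on \<open>D\<close>. A support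
  coordinate of \<open>D\<close> vanishes on the kernels of its own \<open>q - 1\<close> nonzero multiples.
\<close>

lemma gen_weight_Suc_ge:
  fixes C :: "('i \<Rightarrow> 'a::{field,finite}) set"
  defines "q \<equiv> CARD('a)"
  assumes C: "linear_code I n k C" and "r < k"
  shows "(q ^ Suc r - 1) * gen_weight r C \<le> (q ^ Suc r - q) * gen_weight (Suc r) C"
proof -
  obtain D where D: "subcode D C" "word.dim D = Suc r" "support_weight D = gen_weight (Suc r) C"
    using gen_weight_attained[OF C, of "Suc r"] \<open>r < k\<close> by auto
  have Ds: "word.subspace D" and finD: "finite D"
    using D subcode_finite[OF C] by (auto simp: subcode_def)
  have finsupp: "finite (supp D)"
    using D linear_code_finite_supp[OF C] supp_mono[of D C]
    by (auto simp: subcode_def intro: finite_subset)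
  obtain B where B: "B \<subseteq> D" "word.independent B" "word.span B = D" "card B = Suc r" "finite B"
    using subspace_basis[OF Ds finD] D(2) by metis
  \<comment> \<open>The word \<open>u\<close> lists the values of a functional on the basis
    \<open>B\<close>; so \<open>U\<close> stands for the nonzero functionals on \<open>D\<close> and
    \<open>H u\<close> for their kernels.\<close>
  define f where "f u c = (\<Sum>b\<in>B. word.representation B c b * u b)"
    for u :: "('i \<Rightarrow> 'a) \<Rightarrow> 'a" and c
  define H where "H u = {c \<in> D. f u c = 0}" for u
  define U where "U = words B - {0 :: ('i \<Rightarrow> 'a) \<Rightarrow> 'a}"
  have f_add: "f u (x + y) = f u x + f u y" if "x \<in> D" "y \<in> D" for u x y
    using that B by (simp add: f_def word.representation_add sum.distrib ring_distribs)
  have f_scale: "f u (vscale a x) = a * f u x" if "x \<in> D" for u x a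
    using that B by (simp add: f_def word.representation_scale sum_distrib_left mult.assoc)
  have H_sub: "subcode (H u) D" for u
    using Ds f_add f_scale B
    unfolding subcode_def H_def word.subspace_def
    by (auto simp: f_def word.representation_zero)
  \<comment> \<open>A functional takes at most \<open>q\<close> values, so its kernel keeps at least
    \<open>q ^ r\<close> of the \<open>q ^ Suc r\<close> words.\<close>
  have H_dim: "r \<le> word.dim (H u)" for u
  proof -
    have "q ^ Suc r = card D"
      using card_subspace[OF Ds finD] D(2) by (simp add: q_def)
    also have "\<dots> = card (H u) * card (f u ` D)"
      unfolding H_def using Ds
      by (intro card_eq_card_kernel_times_card_image)
        (auto simp: f_add finD intro: word.subspace_add word.subspace_diff)
    also have "\<dots> \<le> card (H u) * q"
      unfolding q_def by (intro mult_left_mono card_mono) auto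
    finally have "q ^ r \<le> card (H u)"
      using card_field_ge_2[where 'a='a] by (simp add: q_def)
    then show ?thesis
      using H_sub[of u] finD unfolding q_def
      by (subst (asm) card_subspace_le_iff) (auto simp: subcode_def intro: finite_subset)
  qed
  have finU: "finite U"
    unfolding U_def using finite_words[OF B(5)] by simp
  have cardU: "card U = q ^ Suc r - 1"
    unfolding U_def q_def using B finite_words[OF B(5)]
    by (subst card_Diff_singleton) (auto simp: card_words, auto simp: words_def)
  have col: "card {u \<in> U. j \<in> supp (H u)} \<le> q ^ Suc r - q" if j: "j \<in> supp D" for j
  proof -
    \<comment> \<open>\<open>e m\<close> is the functional sending \<open>c\<close> to
      \<open>m * c j\<close>, written in basis coordinates. For nonzero \<open>m\<close> all words
      of its kernel vanish at \<open>j\<close>.\<close>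
    define e where "e m = (\<lambda>b. if b \<in> B then m * b j else 0)" for m :: 'a
    \<comment> \<open>If all basis words vanished at \<open>j\<close>, so would \<open>D\<close>.
      The word \<open>b\<close> shows that \<open>e\<close> is injective and that \<open>e m\<close>
      is nonzero for nonzero \<open>m\<close>.\<close>
    obtain b where b: "b \<in> B" "b j \<noteq> 0"
    proof (rule ccontr)
      assume "\<not> thesis"
      then have "B \<subseteq> {c. c j = 0}" using that by auto
      then have "word.span B \<subseteq> {c. c j = 0}"
        by (rule word.span_minimal) (auto simp: word.subspace_def vscale_def)
      then show False using j B by (auto simp: supp_def)
    qed
    have f_e: "f (e m) c = m * c j" if "c \<in> D" for m c
    proof -
      have apply_sum: "(\<Sum>b\<in>F. vscale (a b) b) j = (\<Sum>b\<in>F. a b * b j)" if "finite F" for a F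
        using that by (induction F rule: finite_induct) (auto simp: vscale_def)
      have "c j = (\<Sum>b\<in>B. vscale (word.representation B c b) b) j"
        using that B by (simp add: word.sum_representation_eq)
      also have "\<dots> = (\<Sum>b\<in>B. word.representation B c b * b j)"
        using B(5) by (rule apply_sum)
      finally show ?thesis
        by (simp add: f_def e_def sum_distrib_left mult_ac)
    qed
    have sub: "e ` (UNIV - {0}) \<subseteq> U"
    proof
      fix u assume "u \<in> e ` (UNIV - {0})"
      then obtain m where m: "u = e m" "m \<noteq> 0" by auto
      then have "u b \<noteq> 0" using b by (simp add: e_def)
      then have "u \<noteq> 0" by auto
      then show "u \<in> U" using m by (simp add: U_def words_def e_def)
    qed
    have "inj e"
    proof (rule injI)
      fix m m' assume "e m = e m'"
      then have "e m b = e m' b" by simp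
      then show "m = m'" using b by (simp add: e_def)
    qed
    then have card_e: "card (e ` (UNIV - {0})) = q - 1"
      by (simp add: card_image inj_on_subset q_def card_Diff_singleton)
    have "{u \<in> U. j \<in> supp (H u)} \<subseteq> U - e ` (UNIV - {0})"
      by (auto simp: supp_def H_def f_e)
    then have "card {u \<in> U. j \<in> supp (H u)} \<le> card (U - e ` (UNIV - {0}))"
      using finU by (intro card_mono) auto
    also have "\<dots> = card U - (q - 1)"
      using card_Diff_subset[OF finite_subset[OF sub finU] sub] card_e by simp
    finally have "card {u \<in> U. j \<in> supp (H u)} \<le> card U - (q - 1)" .
    then show ?thesis
      using cardU card_field_ge_2[where 'a='a] by (simp add: q_def)
  qed
  have "(q ^ Suc r - 1) * gen_weight r C = (\<Sum>u\<in>U. gen_weight r C)"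
    by (simp add: cardU)
  also have "\<dots> \<le> (\<Sum>u\<in>U. card (supp (H u)))"
  proof (rule sum_mono)
    fix u
    have "subcode (H u) C" using H_sub[of u] D(1) by (auto simp: subcode_def)
    from gen_weight_le_of_le_dim[OF C this H_dim] show "gen_weight r C \<le> card (supp (H u))"
      by (simp add: support_weight_def)
  qed
  also have "\<dots> = (\<Sum>u\<in>U. card {j \<in> supp D. j \<in> supp (H u)})"
  proof (rule sum.cong[OF refl])
    fix u
    have "supp (H u) \<subseteq> supp D" using H_sub[of u] by (intro supp_mono) (simp add: subcode_def)
    then have "supp (H u) = {j \<in> supp D. j \<in> supp (H u)}" by auto
    then show "card (supp (H u)) = card {j \<in> supp D. j \<in> supp (H u)}" by simp
  qed
  \<comment> \<open>Double counting of the pairs \<open>(u, j)\<close> with \<open>j\<close> in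
    \<open>supp (H u)\<close>.\<close>
  also have "\<dots> = (\<Sum>j\<in>supp D. card {u \<in> U. j \<in> supp (H u)})"
    using sum.swap_restrict[OF finU finsupp, of "\<lambda>_ _. 1 :: nat" "\<lambda>u j. j \<in> supp (H u)"] by simp
  also have "\<dots> \<le> (\<Sum>j\<in>supp D. q ^ Suc r - q)"
    by (rule sum_mono) (rule col)
  also have "\<dots> = (q ^ Suc r - q) * gen_weight (Suc r) C"
    using D(3) by (simp add: support_weight_def)
  finally show ?thesis .
qed

section \<open>The generalized Griesmer bound\<close>

lemma gauss_num_1: "2 \<le> q \<Longrightarrow> gauss_num q 1 = 1"
  by (simp add: gauss_num_def)

text \<open>Splits a geometric sum of \<open>m + s\<close> terms into its first \<open>s\<close>
  terms and \<open>q ^ s\<close> times the sum of \<open>m\<close> terms.\<close>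

lemma gauss_num_add:
  assumes "2 \<le> q"
  shows "gauss_num q (m + s) = real q ^ s * gauss_num q m + gauss_num q s"
  by (simp add: gauss_num_def power_add right_diff_distrib mult.commute flip: add_divide_distrib)

lemma gauss_num_pos:
  assumes "2 \<le> q" "1 \<le> r"
  shows "0 < gauss_num q r"
  using assms one_less_power[of "real q" r] by (simp add: gauss_num_def)

lemma gen_griesmer_bound_strict_mono:
  assumes "x < y"
  shows "gen_griesmer_bound q r k x < gen_griesmer_bound q r k y"
proof -
  \<comment> \<open>For \<open>q = 0\<close> the numerator and denominator of
    \<open>gauss_num\<close> are both at most zero; for \<open>q = 1\<close> division by zero gives
    zero.\<close>
  have "0 \<le> real q ^ i * gauss_num q r" for i
    by (cases "q = 0") (auto simp: gauss_num_def power_0_left zero_le_divide_iff)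
  then have "(\<Sum>i = 1..k - r. nat \<lceil>real x / (real q ^ i * gauss_num q r)\<rceil>)
      \<le> (\<Sum>i = 1..k - r. nat \<lceil>real y / (real q ^ i * gauss_num q r)\<rceil>)"
    using assms by (intro sum_mono nat_mono ceiling_mono divide_right_mono) auto
  then show ?thesis
    using assms by (simp add: gen_griesmer_bound_def)
qed

text \<open>The averaging inequality divided by \<open>q - 1\<close>, using
  \<open>q ^ Suc r - q = q * (q ^ r - 1)\<close>. Passing to the reals removes truncated
  subtraction.\<close>

lemma gauss_num_gen_weight_Suc:
  fixes C :: "('i \<Rightarrow> 'a::{field,finite}) set"
  defines "q \<equiv> CARD('a)"
  assumes C: "linear_code I n k C" and "r < k"
  shows "gauss_num q (Suc r) * gen_weight r C \<le> real q * gauss_num q r * gen_weight (Suc r) C"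
proof -
  have q: "2 \<le> q" unfolding q_def by (rule card_field_ge_2)
  then have "1 \<le> q ^ Suc r" "q \<le> q ^ Suc r" by (simp_all add: Suc_le_eq)
  moreover have "real ((q ^ Suc r - 1) * gen_weight r C) \<le> real ((q ^ Suc r - q) * gen_weight (Suc r) C)"
    using gen_weight_Suc_ge[OF C \<open>r < k\<close>] unfolding q_def of_nat_le_iff .
  ultimately have "(real q ^ Suc r - 1) * gen_weight r C \<le> (real q ^ Suc r - real q) * gen_weight (Suc r) C"
    by (simp add: of_nat_diff)
  then have "(real q ^ Suc r - 1) * gen_weight r C / (real q - 1)
      \<le> (real q ^ Suc r - real q) * gen_weight (Suc r) C / (real q - 1)"
    using q by (intro divide_right_mono) auto
  then show ?thesis
    by (simp add: gauss_num_def right_diff_distrib)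
qed

text \<open>The one-step inequalities are multiplied together, and the intermediate Gaussian numbers
  cancel.\<close>

lemma gauss_num_gen_weight_le:
  fixes C :: "('i \<Rightarrow> 'a::{field,finite}) set"
  defines "q \<equiv> CARD('a)"
  assumes C: "linear_code I n k C" and r: "1 \<le> r" and "r + s \<le> k"
  shows "gauss_num q (r + s) * gen_weight r C \<le> real q ^ s * gauss_num q r * gen_weight (r + s) C"
  using \<open>r + s \<le> k\<close>
proof (induction s)
  case 0
  then show ?case by simp
next
  case (Suc s)
  have q: "2 \<le> q" unfolding q_def by (rule card_field_ge_2)
  let ?g = "gauss_num q" and ?d = "\<lambda>i. real (gen_weight i C)"
  have pos: "0 < ?g (r + s)" "0 < ?g (Suc (r + s))" "0 < ?g r"
    using gauss_num_pos[OF q] r by auto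
  \<comment> \<open>The extra factor \<open>?g (r + s)\<close>, positive because
    \<open>1 \<le> r\<close>, is cancelled at the end.\<close>
  have "?g (r + s) * (?g (Suc (r + s)) * ?d r) = ?g (Suc (r + s)) * (?g (r + s) * ?d r)"
    by simp
  also have "\<dots> \<le> ?g (Suc (r + s)) * (real q ^ s * ?g r * ?d (r + s))"
    using Suc pos by (intro mult_left_mono) auto
  also have "\<dots> = real q ^ s * ?g r * (?g (Suc (r + s)) * ?d (r + s))"
    by simp
  also have "\<dots> \<le> real q ^ s * ?g r * (real q * ?g (r + s) * ?d (Suc (r + s)))"
    using gauss_num_gen_weight_Suc[OF C, of "r + s"] Suc.prems pos unfolding q_def
    by (intro mult_left_mono) auto
  also have "\<dots> = ?g (r + s) * (real q ^ Suc s * ?g r * ?d (Suc (r + s)))"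
    by simp
  finally show ?case
    using pos by simp
qed

text \<open>In the chained inequality, \<open>q ^ s * gauss_num q h\<close> is
  \<open>gauss_num q (h + s) - gauss_num q s\<close>.\<close>

lemma gen_weight_diff_ge:
  fixes C :: "('i \<Rightarrow> 'a::{field,finite}) set"
  defines "q \<equiv> CARD('a)"
  assumes C: "linear_code I n k C" and "1 \<le> h" "h + s \<le> k"
  shows "gauss_num q s * gen_weight (h + s) C \<le>
    gauss_num q (h + s) * (real (gen_weight (h + s) C) - gen_weight h C)"
  using gauss_num_gen_weight_le[OF assms(2-4)] gauss_num_add[OF card_field_ge_2[where 'a='a], of h s]
  by (simp add: q_def algebra_simps)

text \<open>The left side is the summand of index \<open>Suc s\<close> in the generalized bound
  before rounding. One averaging step bounds \<open>gen_weight (r + s) C\<close> by a multiple of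
  the increment, the chain bounds \<open>gen_weight r C\<close> by a multiple of
  \<open>gen_weight (r + s) C\<close>, and \<open>gauss_num q (r + s)\<close> cancels.\<close>

lemma gen_weight_Suc_diff_ge:
  fixes C :: "('i \<Rightarrow> 'a::{field,finite}) set"
  defines "q \<equiv> CARD('a)"
  assumes C: "linear_code I n k C" and r: "1 \<le> r" and "r + s < k"
  shows "gen_weight r C / (real q ^ Suc s * gauss_num q r) \<le>
    real (gen_weight (r + Suc s) C) - gen_weight (r + s) C"
proof -
  have q: "2 \<le> q" unfolding q_def by (rule card_field_ge_2)
  let ?g = "gauss_num q" and ?d = "\<lambda>i. real (gen_weight i C)"
  let ?D = "?d (r + Suc s) - ?d (r + s)"
  have pos: "0 < ?g (r + s)" "0 < ?g r"
    using gauss_num_pos[OF q] r by auto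
  have "?g (Suc (r + s)) = real q * ?g (r + s) + 1"
    using gauss_num_add[OF q, of "r + s" 1] gauss_num_1[OF q] by simp
  then have step: "?d (r + s) \<le> real q * ?g (r + s) * ?D"
    using gauss_num_gen_weight_Suc[OF C, of "r + s"] \<open>r + s < k\<close>
    by (simp add: q_def algebra_simps)
  have "?g (r + s) * ?d r \<le> real q ^ s * ?g r * ?d (r + s)"
    using gauss_num_gen_weight_le[OF C r, of s] \<open>r + s < k\<close> by (simp add: q_def)
  also have "\<dots> \<le> real q ^ s * ?g r * (real q * ?g (r + s) * ?D)"
    using step pos by (intro mult_left_mono) auto
  also have "\<dots> = ?g (r + s) * (real q ^ Suc s * ?g r * ?D)"
    by simp
  finally have "?d r \<le> real q ^ Suc s * ?g r * ?D"
    using pos by simp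
  then show ?thesis
    using pos q by (simp add: divide_le_eq mult_ac)
qed

lemma gen_weight_less_Suc:
  fixes C :: "('i \<Rightarrow> 'a::{field,finite}) set"
  assumes C: "linear_code I n k C" and "1 \<le> r" "r < k"
  shows "gen_weight r C < gen_weight (Suc r) C"
proof -
  have "0 < gen_weight r C / (real CARD('a) ^ Suc 0 * gauss_num CARD('a) r)"
    using gen_weight_pos[OF C, of r] gauss_num_pos[OF card_field_ge_2[where 'a='a], of r] assms
      card_field_ge_2[where 'a='a] by simp
  then show ?thesis
    using gen_weight_Suc_diff_ge[OF C, of r 0] assms by simp
qed

text \<open>Weight increments are integers, so each is at least the rounded-up summand. Summing from
  the \<open>r\<close>-th to the \<open>k\<close>-th weight telescopes.\<close>

lemma griesmer_le_support_weight:
  fixes C :: "('i \<Rightarrow> 'a::{field,finite}) set"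
  assumes C: "linear_code I n k C" and r: "1 \<le> r" and "r \<le> k"
  shows "gen_griesmer_bound CARD('a) r k (gen_weight r C) \<le> support_weight C"
proof -
  let ?t = "\<lambda>i. nat \<lceil>gen_weight r C / (real CARD('a) ^ i * gauss_num CARD('a) r)\<rceil>"
  have "gen_weight r C + (\<Sum>i = 1..s. ?t i) \<le> gen_weight (r + s) C" if "r + s \<le> k" for s
    using that
  proof (induction s)
    case 0
    then show ?case by simp
  next
    case (Suc s)
    have "?t (Suc s) \<le> gen_weight (r + Suc s) C - gen_weight (r + s) C"
      using gen_weight_Suc_diff_ge[OF C r, of s] gen_weight_less_Suc[OF C, of "r + s"] Suc.prems r
      by (simp add: nat_le_iff ceiling_le_iff of_nat_diff)
    \<comment> \<open>Strict growth ensures that the natural-number difference is not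
      truncated.\<close>
    moreover have "gen_weight (r + s) C < gen_weight (r + Suc s) C"
      using gen_weight_less_Suc[OF C, of "r + s"] Suc.prems r by simp
    moreover have "(\<Sum>i = 1..Suc s. ?t i) = (\<Sum>i = 1..s. ?t i) + ?t (Suc s)"
      by simp
    ultimately show ?case
      using Suc.IH Suc.prems by linarith
  qed
  from this[of "k - r"] have "gen_griesmer_bound CARD('a) r k (gen_weight r C) \<le> gen_weight k C"
    using \<open>r \<le> k\<close> by (simp add: gen_griesmer_bound_def)
  also have "\<dots> \<le> support_weight C"
    using C by (intro gen_weight_le) (auto simp: linear_code_def subcode_def)
  finally show ?thesis .
qed

text \<open>Distances are weights of differences, and one-dimensional subcodes are spans of single
  nonzero words. The predicates under \<open>LEAST\<close> agree for every \<open>d\<close>, which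
  covers the zero code too.\<close>

lemma min_distance_eq_gen_weight:
  fixes C :: "('i \<Rightarrow> 'a::{field,finite}) set"
  assumes C: "word.subspace C"
  shows "min_distance C = gen_weight 1 C"
proof -
  have "(\<exists>c\<in>C. \<exists>c'\<in>C. c \<noteq> c' \<and> hamming_dist c c' = d) \<longleftrightarrow>
    (\<exists>A. subcode A C \<and> word.dim A = 1 \<and> support_weight A = d)" (is "?L \<longleftrightarrow> ?R") for d
  proof -
    have span: "support_weight (word.span {c}) = hamming_dist c 0" for c :: "'i \<Rightarrow> 'a"
    proof -
      have "supp (word.span {c}) = {j. c j \<noteq> 0}"
        by (auto simp: supp_def word.span_singleton vscale_def intro!: exI[of _ 1])
      then show ?thesis by (simp add: support_weight_def hamming_dist_def)
    qed
    have dim: "word.dim (word.span {c}) = 1 \<longleftrightarrow> c \<noteq> 0" for c :: "'i \<Rightarrow> 'a"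
    proof (cases "c = 0")
      case True
      then have "word.span {c} = word.span {}" by (auto simp: word.span_singleton)
      then have "word.dim (word.span {c}) = 0"
        using word.dim_span_eq_card_independent[OF word.independent_empty] by simp
      then show ?thesis using True by simp
    next
      case False
      then show ?thesis by (simp add: word.dim_eq_card_independent)
    qed
    show ?thesis
    proof
      assume ?L
      then obtain c c' where c: "c \<in> C" "c' \<in> C" "c \<noteq> c'" "hamming_dist c c' = d" by auto
      have "subcode (word.span {c - c'}) C"
        using word.span_minimal[of "{c - c'}" C] word.subspace_diff[OF C c(1,2)] C by (simp add: subcode_def)
      moreover have "hamming_dist (c - c') 0 = d"
        using c by (simp add: hamming_dist_def)
      ultimately show ?R using dim[of "c - c'"] span[of "c - c'"] c by auto
    next
      assume ?R
      then obtain A where A: "subcode A C" "word.dim A = 1" "support_weight A = d" by auto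
      obtain B where B: "B \<subseteq> A" "A \<subseteq> word.span B" "card B = 1"
        using word.basis_exists A(2) by metis
      then obtain c where c: "B = {c}" by (auto simp: card_1_singleton_iff)
      have "A = word.span {c}"
        using A B c by (auto simp: subcode_def word.span_subspace)
      have "c \<in> C" "c \<noteq> 0" "hamming_dist c 0 = d"
        using A B(1) c dim[of c] span[of c] \<open>A = word.span {c}\<close> by (auto simp: subcode_def)
      then show ?L
        using word.subspace_0[OF C] by blast
    qed
  qed
  then show ?thesis
    by (simp add: min_distance_def gen_weight_def)
qed

section \<open>Residual codes\<close>

text \<open>Puncturing is a linear map on \<open>C\<close> whose kernel contains \<open>A\<close>
  and is supported in \<open>supp A\<close>. A kernel of dimension above \<open>h\<close> would have
  weight at most the \<open>h\<close>-th one, against strict growth of the weights. So the kernel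
  has dimension \<open>h\<close>, and taking preimages of subcodes of the residual adds exactly
  \<open>h\<close> to the dimension.\<close>

lemma residual_props:
  fixes C :: "('i \<Rightarrow> 'a::{field,finite}) set"
  defines "R A \<equiv> residual C A"
  assumes C: "linear_code I n k C" and h: "1 \<le> h" "h < k"
    and A: "subcode A C" "word.dim A = h" "support_weight A = gen_weight h C"
  shows linear_code_residual: "linear_code (supp (R A)) (support_weight (R A)) (k - h) (R A)"
    and support_weight_residual: "support_weight (R A) = support_weight C - gen_weight h C"
    and gen_weight_residual: "s \<le> k - h \<Longrightarrow> gen_weight (h + s) C \<le> gen_weight h C + gen_weight s (R A)"
proof -
  define p :: "('i \<Rightarrow> 'a) \<Rightarrow> 'i \<Rightarrow> 'a" where "p c = (\<lambda>j. if j \<in> supp A then 0 else c j)" for c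
  have R: "R A = p ` C" by (simp add: R_def residual_def p_def[abs_def])
  have Cs: "word.subspace C" and finC: "finite C" and finsupp: "finite (supp C)"
    using C linear_code_finite[OF C] linear_code_finite_supp[OF C] by (auto simp: linear_code_def)
  have p_add: "p (x + y) = p x + p y" and p_scale: "p (vscale a x) = vscale a (p x)"
    and p_0: "p 0 = 0" for x y a
    by (auto simp: p_def vscale_def fun_eq_iff)
  define K where "K = {c \<in> C. p c = 0}"
  have lift_sub: "subcode {c \<in> C. p c \<in> B} C" if "word.subspace B" for B
    using that Cs by (auto simp: subcode_def word.subspace_def p_add p_scale p_0)
  have K_sub: "subcode K C"
    using lift_sub[of "{0}"] by (simp add: K_def)
  have finK: "finite K" using K_sub finC by (auto simp: subcode_def intro: finite_subset)
  have "A \<subseteq> K"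
    using A by (auto simp: subcode_def K_def p_def supp_def fun_eq_iff)
  have "supp K \<subseteq> supp A"
    by (auto simp: supp_def K_def p_def fun_eq_iff split: if_splits)
  have finA: "finite (supp A)"
    using finsupp A supp_mono[of A C] by (auto simp: subcode_def intro: finite_subset)
  have "word.dim K = h"
  proof (rule antisym)
    show "h \<le> word.dim K"
      using card_mono[OF finK \<open>A \<subseteq> K\<close>] A K_sub finK card_subspace[of A] subcode_finite[OF C, of A]
      by (subst card_subspace_le_iff[symmetric]) (auto simp: subcode_def)
    show "word.dim K \<le> h"
    proof (rule ccontr)
      assume "\<not> ?thesis"
      then have "gen_weight (Suc h) C \<le> support_weight K"
        using gen_weight_le_of_le_dim[OF C K_sub] by simp
      also have "\<dots> \<le> gen_weight h C"
        unfolding A(3)[symmetric] support_weight_def using finA \<open>supp K \<subseteq> supp A\<close> by (rule card_mono)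
      finally show False using gen_weight_less_Suc[OF C h] by simp
    qed
  qed
  then have cardK: "card K = CARD('a) ^ h"
    using K_sub finK card_subspace[of K] by (simp add: subcode_def)
  \<comment> \<open>Since \<open>0\<close> lies in \<open>B\<close>, the preimage of
    \<open>B\<close> contains \<open>K\<close>, and its fibres over \<open>B\<close> are cosets of
    \<open>K\<close>.\<close>
  have cardlift: "card {c \<in> C. p c \<in> B} = CARD('a) ^ h * card B"
    if B: "subcode B (R A)" for B
  proof -
    let ?S = "{c \<in> C. p c \<in> B}"
    have S: "word.subspace ?S" using lift_sub[of B] B by (simp add: subcode_def)
    have "card ?S = card {c \<in> ?S. p c = 0} * card (p ` ?S)"
      by (rule card_eq_card_kernel_times_card_image)
        (use finC p_add word.subspace_add[OF S] word.subspace_diff[OF S] in auto)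
    also have "{c \<in> ?S. p c = 0} = K"
      using B by (auto simp: K_def subcode_def word.subspace_0)
    also have "p ` ?S = B"
      using B by (auto simp: subcode_def R)
    finally show ?thesis by (simp add: cardK)
  qed
  have Rs: "word.subspace (R A)"
    unfolding R word.subspace_def
  proof (intro conjI ballI allI)
    show "0 \<in> p ` C" using word.subspace_0[OF Cs] p_0 by force
    show "x + y \<in> p ` C" if "x \<in> p ` C" "y \<in> p ` C" for x y
      using that word.subspace_add[OF Cs] by (auto simp flip: p_add)
    show "vscale a x \<in> p ` C" if "x \<in> p ` C" for a x
      using that word.subspace_scale[OF Cs] by (auto simp flip: p_scale)
  qed
  have suppR: "supp (R A) = supp C - supp A"
    by (auto simp: R supp_def p_def)
  have suppAC: "supp A \<subseteq> supp C"
    using A supp_mono by (auto simp: subcode_def)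
  show w: "support_weight (R A) = support_weight C - gen_weight h C"
    using suppR suppAC finA unfolding A(3)[symmetric] by (simp add: support_weight_def card_Diff_subset)
  have "word.dim (R A) = k - h"
  proof (rule dim_eqI[OF Rs])
    show "finite (R A)" using finC by (simp add: R)
    have "CARD('a) ^ h * card (R A) = card C"
    proof -
      have "{c \<in> C. p c \<in> R A} = C" by (auto simp: R)
      then show ?thesis using cardlift[of "R A"] Rs by (simp add: subcode_def)
    qed
    also have "\<dots> = CARD('a) ^ h * CARD('a) ^ (k - h)"
      using card_subspace[OF Cs finC] C h by (simp add: linear_code_def flip: power_add)
    finally show "card (R A) = CARD('a) ^ (k - h)" by simp
  qed
  then show lin: "linear_code (supp (R A)) (support_weight (R A)) (k - h) (R A)"
    using Rs suppR finsupp by (auto simp: linear_code_def support_weight_def words_def supp_def)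
  show "gen_weight (h + s) C \<le> gen_weight h C + gen_weight s (R A)" if "s \<le> k - h"
  proof -
    obtain B where B: "subcode B (R A)" "word.dim B = s" "support_weight B = gen_weight s (R A)"
      using gen_weight_attained[OF lin \<open>s \<le> k - h\<close>] by blast
    let ?S = "{c \<in> C. p c \<in> B}"
    have S: "subcode ?S C" using lift_sub[of B] B by (simp add: subcode_def)
    have finB: "finite B" using subcode_finite[OF lin B(1)] .
    have "word.dim ?S = h + s"
    proof (rule dim_eqI)
      show "card ?S = CARD('a) ^ (h + s)"
        using cardlift[OF B(1)] card_subspace[of B] B finB by (simp add: subcode_def power_add)
    qed (use S finC in \<open>auto simp: subcode_def\<close>)
    then have "gen_weight (h + s) C \<le> support_weight ?S"
      by (rule gen_weight_le[OF S])
    \<comment> \<open>Outside \<open>supp A\<close> a word agrees with its punctured image, so the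
      preimage can gain support only inside \<open>supp A\<close>.\<close>
    also have "\<dots> \<le> card (supp A \<union> supp B)"
      unfolding support_weight_def
    proof (rule card_mono)
      show "finite (supp A \<union> supp B)"
        using finA B(1) supp_mono[of B "R A"] suppR finsupp
        by (auto simp: subcode_def intro: finite_subset)
      show "supp ?S \<subseteq> supp A \<union> supp B"
      proof
        fix j assume "j \<in> supp ?S"
        then obtain c where c: "c \<in> C" "p c \<in> B" "c j \<noteq> 0" by (auto simp: supp_def)
        then have "p c j \<noteq> 0" if "j \<notin> supp A" using that by (simp add: p_def)
        then show "j \<in> supp A \<union> supp B" using c unfolding supp_def[of B] by blast
      qed
    qed
    also have "\<dots> \<le> gen_weight h C + gen_weight s (R A)"
      using card_Un_le[of "supp A" "supp B"] A B by (simp add: support_weight_def)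
    finally show ?thesis .
  qed
qed

text \<open>
  The assumption on the length closes the cycle
  \<open>n(R) \<le> g(d\<^sub>h\<^sub>+\<^sub>s - d\<^sub>h) \<le> g(d\<^sub>s(R)) \<le> n(R)\<close>, and \<open>g\<close> is strictly increasing.
\<close>

lemma residual_gen_griesmer:
  fixes C :: "('i \<Rightarrow> 'a::{field,finite}) set"
  assumes C: "linear_code I n k C" and h: "1 \<le> h" and s: "1 \<le> s" "h + s \<le> k"
    and A: "subcode A C" "word.dim A = h" "support_weight A = gen_weight h C"
    and len: "support_weight C - gen_weight h C \<le>
      gen_griesmer_bound CARD('a) s (k - h) (gen_weight (h + s) C - gen_weight h C)"
  defines "R \<equiv> residual C A"
  shows "gen_weight s R = gen_weight (h + s) C - gen_weight h C"
    and "gen_griesmer_code s (supp R) (support_weight R) (k - h) R"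
proof -
  let ?g = "gen_griesmer_bound CARD('a) s (k - h)" and ?x = "gen_weight (h + s) C - gen_weight h C"
  have "h < k" using s by simp
  note R = residual_props[OF C h \<open>h < k\<close> A, folded R_def]
  have bound: "?g (gen_weight s R) \<le> support_weight R"
    using griesmer_le_support_weight[OF R(1)] s by simp
  have "s \<le> k - h" using s by simp
  from R(3)[OF this] have le: "?x \<le> gen_weight s R" by simp
  have "\<not> ?x < gen_weight s R"
    using gen_griesmer_bound_strict_mono[of ?x "gen_weight s R" "CARD('a)" s "k - h"] bound len R(2)
    by linarith
  with le show eq: "gen_weight s R = ?x" by simp
  have "support_weight R = ?g (gen_weight s R)"
    using bound len R(2) unfolding eq by simp
  then show "gen_griesmer_code s (supp R) (support_weight R) (k - h) R"
    using R(1) s by (simp add: gen_griesmer_code_def)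
qed

text \<open>Both sums have \<open>k - (h + s)\<close> summands and are compared term by term: by
  \<open>gen_weight_diff_ge\<close>, the ratio of the weight to its Gaussian number does not
  decrease in passing from \<open>h + s\<close> to \<open>s\<close>.\<close>

lemma gen_griesmer_bound_diff_le:
  fixes C :: "('i \<Rightarrow> 'a::{field,finite}) set"
  defines "q \<equiv> CARD('a)"
  assumes C: "linear_code I n k C" and h: "1 \<le> h" and s: "1 \<le> s" "h + s \<le> k"
  shows "gen_griesmer_bound q (h + s) k (gen_weight (h + s) C) - gen_weight h C \<le>
    gen_griesmer_bound q s (k - h) (gen_weight (h + s) C - gen_weight h C)"
proof -
  let ?d = "gen_weight (h + s) C" and ?x = "gen_weight (h + s) C - gen_weight h C"
  have q: "2 \<le> q" unfolding q_def by (rule card_field_ge_2)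
  have pos: "0 < gauss_num q (h + s)" "0 < gauss_num q s"
    using gauss_num_pos[OF q] h s by auto
  have "gauss_num q s * ?d \<le> gauss_num q (h + s) * (real ?d - gen_weight h C)"
    using gen_weight_diff_ge[OF C h s(2)] by (simp add: q_def)
  \<comment> \<open>The truncated difference \<open>?x\<close> is never below the real one.\<close>
  also have "\<dots> \<le> gauss_num q (h + s) * ?x"
    using pos by (intro mult_left_mono) auto
  finally have "real ?d / gauss_num q (h + s) \<le> real ?x / gauss_num q s"
    using pos by (simp add: field_simps)
  then have "real ?d / gauss_num q (h + s) / real q ^ i \<le> real ?x / gauss_num q s / real q ^ i" for i
    by (rule divide_right_mono) simp
  then have "(\<Sum>i = 1..k - (h + s). nat \<lceil>real ?d / (real q ^ i * gauss_num q (h + s))\<rceil>)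
      \<le> (\<Sum>i = 1..k - (h + s). nat \<lceil>real ?x / (real q ^ i * gauss_num q s)\<rceil>)"
    by (intro sum_mono nat_mono ceiling_mono) (simp add: mult.commute)
  then show ?thesis
    by (simp add: gen_griesmer_bound_def)
qed

text \<open>Without its leading term the generalized bound is a sum of \<open>k - r\<close>
  ceilings. The first is at most the weight increment, which leads the ordinary bound; the others
  are matched with an index shift by one.\<close>

lemma griesmer_bound_Suc_diff_ge:
  fixes C :: "('i \<Rightarrow> 'a::{field,finite}) set"
  defines "q \<equiv> CARD('a)"
  assumes C: "linear_code I n k C" and r: "1 \<le> r" "r < k"
  shows "gen_griesmer_bound q r k (gen_weight r C) - gen_weight r C \<le>
    griesmer_bound q (k - r) (gen_weight (r + 1) C - gen_weight r C)"
proof -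
  let ?d = "gen_weight r C" and ?x = "gen_weight (r + 1) C - gen_weight r C"
  have q: "2 \<le> q" unfolding q_def by (rule card_field_ge_2)
  \<comment> \<open>\<open>m\<close> is the number of ceilings in the ordinary bound for dimension
    \<open>k - r\<close>.\<close>
  obtain m where m: "k - r = Suc m" using r by (metis Suc_diff_Suc)
  have split: "(\<Sum>i = 1..Suc m. f i) = f 1 + (\<Sum>i = 1..m. f (Suc i))" for f :: "nat \<Rightarrow> nat"
    by (induction m) simp_all
  have "real ?d / (real q * gauss_num q r) \<le> real (gen_weight (r + 1) C) - ?d"
    using gen_weight_Suc_diff_ge[OF C r(1), of 0] r by (simp add: q_def)
  also have "\<dots> \<le> real ?x" by simp
  finally have le: "real ?d / (real q * gauss_num q r) \<le> real ?x" .
  then have "real ?d / (real q * gauss_num q r) / real q ^ i \<le> real ?x / real q ^ i" for i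
    by (rule divide_right_mono) simp
  then have "(\<Sum>i = 1..m. nat \<lceil>real ?d / (real q ^ Suc i * gauss_num q r)\<rceil>)
      \<le> (\<Sum>i = 1..m. nat \<lceil>real ?x / (real q ^ i * gauss_num q 1)\<rceil>)"
    by (intro sum_mono nat_mono ceiling_mono) (simp add: gauss_num_1[OF q, simplified] mult_ac)
  moreover have "nat \<lceil>real ?d / (real q ^ 1 * gauss_num q r)\<rceil> \<le> ?x"
    using le by (simp add: nat_le_iff ceiling_le_iff)
  ultimately have "(\<Sum>i = 1..Suc m. nat \<lceil>real ?d / (real q ^ i * gauss_num q r)\<rceil>)
      \<le> ?x + (\<Sum>i = 1..m. nat \<lceil>real ?x / (real q ^ i * gauss_num q 1)\<rceil>)"
    unfolding split by (intro add_mono)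
  then show ?thesis
    by (simp add: gen_griesmer_bound_def m)
qed

theorem theorem5p3:
  fixes C :: "('i \<Rightarrow> 'a::{field,finite}) set" and I :: "'i set" and n k r :: nat
  assumes "1 \<le> r" and "r \<le> k"
    and "linear_code I n k C"
    and "gen_griesmer_code r I n k C"
  shows "(\<forall>h A. 1 \<le> h \<and> h < r \<and> subcode A C \<and> word.dim A = h \<and>
            support_weight A = gen_weight h C \<longrightarrow>
            (let R = residual C A in
               linear_code (supp R) (effective_length R) (k - h) R \<and>
               effective_length R =
                 gen_griesmer_bound CARD('a) (r - h) (k - h) (gen_weight r C - gen_weight h C) \<and>
               gen_weight (r - h) R = gen_weight r C - gen_weight h C \<and>
               gen_griesmer_code (r - h) (supp R) (effective_length R) (k - h) R)) \<and>
         (r < k \<longrightarrow>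
           (\<forall>A. subcode A C \<and> word.dim A = r \<and> support_weight A = gen_weight r C \<longrightarrow>
            (let R = residual C A in
               linear_code (supp R)
                 (griesmer_bound CARD('a) (k - r) (gen_weight (r + 1) C - gen_weight r C)) (k - r) R \<and>
               min_distance R = gen_weight (r + 1) C - gen_weight r C \<and>
               griesmer_code (supp R) (effective_length R) (k - r) R)))"
proof -
  note C = assms(3)
  \<comment> \<open>Full length of \<open>C\<close> turns the equation for \<open>n\<close> into one
    for its support weight.\<close>
  have len: "support_weight C = gen_griesmer_bound CARD('a) r k (gen_weight r C)"
    using assms(4) by (simp add: gen_griesmer_code_def)
  \<comment> \<open>Combined with \<open>len\<close>, the comparison of bounds is the length
    condition of \<open>residual_gen_griesmer\<close>, here with \<open>s = r - h\<close>.\<close>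
  have part1: "gen_weight (r - h) (residual C A) = gen_weight r C - gen_weight h C \<and>
      gen_griesmer_code (r - h) (supp (residual C A)) (support_weight (residual C A)) (k - h) (residual C A)"
    if "1 \<le> h" "h < r" "subcode A C" "word.dim A = h" "support_weight A = gen_weight h C" for h A
    using residual_gen_griesmer[OF C, of h "r - h" A] gen_griesmer_bound_diff_le[OF C, of h "r - h"]
      that len assms(2) by simp
  have part2: "gen_weight 1 (residual C A) = gen_weight (r + 1) C - gen_weight r C \<and>
      griesmer_code (supp (residual C A)) (support_weight (residual C A)) (k - r) (residual C A)" (is ?G)
      "linear_code (supp (residual C A))
        (griesmer_bound CARD('a) (k - r) (gen_weight (r + 1) C - gen_weight r C)) (k - r) (residual C A)" (is ?L)
    if "r < k" "subcode A C" "word.dim A = r" "support_weight A = gen_weight r C" for A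
  proof -
    show ?G
      using residual_gen_griesmer[OF C, of r 1 A] griesmer_bound_Suc_diff_ge[OF C, of r]
        that len assms(1) by simp
    then have L: "linear_code (supp (residual C A)) (support_weight (residual C A)) (k - r) (residual C A)"
      and eq: "support_weight (residual C A) = griesmer_bound CARD('a) (k - r) (gen_weight 1 (residual C A))"
      and gw: "gen_weight 1 (residual C A) = gen_weight (r + 1) C - gen_weight r C"
      unfolding gen_griesmer_code_def by blast+
    show ?L
      using L unfolding eq gw .
  qed
  \<comment> \<open>The Griesmer property speaks of the first generalized weight; since the residual
    is a subspace, that weight is its minimum distance.\<close>
  have min_dist: "min_distance (residual C A) = gen_weight (r + 1) C - gen_weight r C"
    if "r < k" "subcode A C" "word.dim A = r" "support_weight A = gen_weight r C" for A
    using linear_code_residual[OF C assms(1) that] part2(1)[OF that]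
    by (simp add: min_distance_eq_gen_weight linear_code_def)
  show ?thesis
  proof (intro conjI allI impI)
    fix h A
    assume A: "1 \<le> h \<and> h < r \<and> subcode A C \<and> word.dim A = h \<and> support_weight A = gen_weight h C"
    then have "gen_weight (r - h) (residual C A) = gen_weight r C - gen_weight h C"
      and G: "gen_griesmer_code (r - h) (supp (residual C A)) (support_weight (residual C A)) (k - h) (residual C A)"
      using part1[of h A] by blast+
    moreover from G have "linear_code (supp (residual C A)) (support_weight (residual C A)) (k - h) (residual C A)"
      and "support_weight (residual C A) =
        gen_griesmer_bound CARD('a) (r - h) (k - h) (gen_weight (r - h) (residual C A))"
      unfolding gen_griesmer_code_def by blast+
    ultimately show "let R = residual C A in
        linear_code (supp R) (effective_length R) (k - h) R \<and>
        effective_length R =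
          gen_griesmer_bound CARD('a) (r - h) (k - h) (gen_weight r C - gen_weight h C) \<and>
        gen_weight (r - h) R = gen_weight r C - gen_weight h C \<and>
        gen_griesmer_code (r - h) (supp R) (effective_length R) (k - h) R"
      by (simp add: Let_def)
  next
    fix A
    assume "r < k" and "subcode A C \<and> word.dim A = r \<and> support_weight A = gen_weight r C"
    then show "let R = residual C A in
        linear_code (supp R)
          (griesmer_bound CARD('a) (k - r) (gen_weight (r + 1) C - gen_weight r C)) (k - r) R \<and>
        min_distance R = gen_weight (r + 1) C - gen_weight r C \<and>
        griesmer_code (supp R) (effective_length R) (k - r) R"
      using part2[of A] min_dist[of A] unfolding Let_def by blast
  qed
qed

end
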